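(* Let $m\ge 2$ be an integer and let $x\in(0,1)$. Then for every $\lambda\in\Lambda(x)$ we have $$\lim_{\delta\to 0^+}\dim_H\big(\Lambda(x)\cap(\lambda-\delta,\lambda+\delta)\big)=\dim_H K_\lambda=\frac{\log m}{-\log\lambda}.$$
   Context: For $\lambda\in(0,1/m]$, $K_\lambda=\left\{\sum_{i=1}^\infty d_i\lambda^i: d_i\in\{0,1,\ldots,m-1\},\ i\ge 1\right\}\subset\mathbb R$, and for $x\in(0,1)$, $\Lambda(x)=\{\lambda\in(0,1/m]: x\in K_\lambda\}$. $\dim_H$ denotes Hausdorff dimension. *)

theory Defs
  imports "HOL-Analysis.Analysis"
begin

(* diam(U)^s with the conventions of Hausdorff measure: the empty set has weight 0, and
   0^0 = 1, so that the 0-dimensional measure counts points.  The case s = 0 is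
   separate because 0 powr 0 = 0. *)
definition diam_power :: "real \<Rightarrow> 'a::metric_space set \<Rightarrow> ennreal" where
  "diam_power s U =
     (if U = {} then 0 else if s = 0 then 1 else ennreal (diameter U powr s))"

(* Countable covers are sequences; finite covers are padded with empty sets.  Boundedness is
   required explicitly because diameter is unspecified on unbounded sets. *)
definition delta_covers :: "real \<Rightarrow> 'a::metric_space set \<Rightarrow> (nat \<Rightarrow> 'a set) set" where
  "delta_covers \<delta> A =
     {U. A \<subseteq> (\<Union>i. U i) \<and> (\<forall>i. bounded (U i) \<and> diameter (U i) \<le> \<delta>)}"

definition hausdorff_premeasure :: "real \<Rightarrow> real \<Rightarrow> 'a::metric_space set \<Rightarrow> ennreal" where
  "hausdorff_premeasure s \<delta> A = (INF U\<in>delta_covers \<delta> A. \<Sum>i. diam_power s (U i))"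

definition hausdorff_measure :: "real \<Rightarrow> 'a::metric_space set \<Rightarrow> ennreal" where
  "hausdorff_measure s A = (SUP \<delta>\<in>{0<..}. hausdorff_premeasure s \<delta> A)"

(* Extended-real valued; the infimum of the empty set is \<infinity>, and the empty set has dimension 0. *)
definition hausdorff_dim :: "'a::metric_space set \<Rightarrow> ereal" where
  "hausdorff_dim A = (INF s\<in>{s. 0 \<le> s \<and> hausdorff_measure s A = 0}. ereal s)"

(* The digit sequence is indexed from 1 (d 0 is unused), while sums is indexed from 0. *)
definition K_set :: "nat \<Rightarrow> real \<Rightarrow> real set" where
  "K_set m l =
     {y. \<exists>d :: nat \<Rightarrow> nat. (\<forall>i\<ge>1. d i \<in> {0..m - 1}) \<and>
           (\<lambda>i. real (d (Suc i)) * l ^ Suc i) sums y}"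

definition Lambda_set :: "nat \<Rightarrow> real \<Rightarrow> real set" where
  "Lambda_set m x = {l \<in> {0<..1 / real m}. x \<in> K_set m l}"

end

theory Submission
  imports Defs
begin

text \<open>
  For a digit sequence \<open>d\<close>, indexed from 0, let \<open>expansion l d\<close> be the point of \<open>K_set m l\<close> with
  digits \<open>d\<close>. At ratios below \<open>1/m\<close>, \<open>K_set m l\<close> is a faithful metric image of the digit space:
  points whose codes first differ at position \<open>n\<close> are at distance comparable to \<open>l^n\<close>. The theorem
  holds because \<open>Lambda_set m x\<close> has the same structure near \<open>l\<close>. Attach to a ratio \<open>u\<close> in it the
  code of \<open>x\<close> at \<open>u\<close>. For a fixed code the value \<open>expansion u d\<close> increases with \<open>u\<close> at a rate bounded
  above and below, so a change of the code beyond position \<open>n\<close>, which moves the value by about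
  \<open>u^n\<close>, must be compensated by a change of \<open>u\<close> of the same order.

  Two metric principles turn this into dimensions. If points whose codes share \<open>n\<close> digits are
  within \<open>C b^n\<close>, the dimension is at most \<open>log m / (- log b)\<close>
  (\<open>hausdorff_dim_le_if_coded\<close>, by counting words). If the set contains points indexed by
  all digit sequences, and separated by \<open>c a^n\<close> when the sequences first differ at \<open>n\<close>, the dimension is
  at least \<open>log m / (- log a)\<close> (\<open>hausdorff_dim_ge_if_separated\<close>). The latter needs no measure
  on the fractal: reading the sequences as base \<open>m\<close> digits is a Hoelder map onto \<open>[0,1]\<close>, whose
  Lebesgue measure does the work.

  Applied to \<open>K_set m l\<close> these give its dimension. Applied to the ratios in \<open>(l - \<delta>, l + \<delta>)\<close>,
  the upper bound with \<open>b = l + \<delta>\<close> is \<open>hausdorff_dim_Lambda_le\<close>, and the lower bound with any \<open>a < l\<close>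
  is \<open>hausdorff_dim_Lambda_nhd_ge\<close>; letting \<open>a\<close> tend to \<open>l\<close> shows that every neighbourhood has
  dimension at least \<open>log m / (- log l)\<close>, and \<open>\<delta> \<rightarrow> 0\<close> closes the gap from above. The separation fails
  at the ratio \<open>1/m\<close>, where expansions are no longer unique. If \<open>l = 1/m\<close>, the lower bound is taken
  around ratios of the set slightly below \<open>l\<close>, which exist because \<open>x < 1\<close>.
\<close>

section \<open>Bounding the Hausdorff dimension\<close>

lemma hausdorff_premeasure_le_measure:
  assumes "0 < \<delta>"
  shows "hausdorff_premeasure s \<delta> A \<le> hausdorff_measure s A"
  unfolding hausdorff_measure_def using assms by (intro SUP_upper) auto

lemma hausdorff_measure_mono:
  assumes "A \<subseteq> B"
  shows "hausdorff_measure s A \<le> hausdorff_measure s B"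
  unfolding hausdorff_measure_def hausdorff_premeasure_def
proof (intro SUP_mono)
  fix \<delta> :: real assume \<delta>: "\<delta> \<in> {0<..}"
  have "delta_covers \<delta> B \<subseteq> delta_covers \<delta> A"
    using assms unfolding delta_covers_def by blast
  then show "\<exists>\<epsilon>\<in>{0<..}. (INF U\<in>delta_covers \<delta> A. \<Sum>i. diam_power s (U i))
      \<le> (INF U\<in>delta_covers \<epsilon> B. \<Sum>i. diam_power s (U i))"
    using \<delta> by (intro bexI[of _ \<delta>] INF_superset_mono) auto
qed

lemma hausdorff_dim_mono:
  assumes "A \<subseteq> B"
  shows "hausdorff_dim A \<le> hausdorff_dim B"
proof -
  have "hausdorff_measure s A = 0" if "hausdorff_measure s B = 0" for s
    using hausdorff_measure_mono[OF assms, of s] that by simp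
  then show ?thesis
    unfolding hausdorff_dim_def by (intro INF_superset_mono) auto
qed

lemma hausdorff_dim_geI:
  assumes "\<And>t. 0 \<le> t \<Longrightarrow> t < s \<Longrightarrow> hausdorff_measure t A \<noteq> 0"
  shows "ereal s \<le> hausdorff_dim A"
  unfolding hausdorff_dim_def
  by (intro INF_greatest) (use assms in \<open>force simp: not_less[symmetric]\<close>)

lemma hausdorff_dim_leI:
  assumes "0 \<le> s" and "\<And>t. s < t \<Longrightarrow> hausdorff_measure t A = 0"
  shows "hausdorff_dim A \<le> ereal s"
proof (rule ereal_le_epsilon2)
  fix \<epsilon> :: real assume "0 < \<epsilon>"
  then have "hausdorff_dim A \<le> ereal (s + \<epsilon>)"
    unfolding hausdorff_dim_def using assms by (intro INF_lower) auto
  then show "hausdorff_dim A \<le> ereal s + ereal \<epsilon>" by simp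
qed

text \<open>
  A lower bound for covers at the exponent \<open>s\<close> thereby excludes measure zero at all smaller exponents.
  Exponent 0 needs no separate treatment, since every nonempty set has weight 1 there.
\<close>

lemma diam_power_decreasing_exponent:
  assumes "0 \<le> t" "t < s" "bounded U" "diameter U \<le> 1"
  shows "diam_power s U \<le> diam_power t U"
proof -
  have "0 \<le> diameter U" using assms by (intro diameter_ge_0)
  moreover have "diameter U powr s \<le> 1"
    using calculation assms by (intro powr_le1) auto
  moreover have "diameter U powr s \<le> diameter U powr t"
    using calculation assms by (intro powr_mono') auto
  ultimately show ?thesis
    using assms unfolding diam_power_def by (auto intro!: ennreal_leI)
qed

text \<open>
  Lower bounds come from Lebesgue measure. If \<open>\<psi> i\<close> is an \<open>s\<close>-Hoelder function of the point
  \<open>\<phi> i\<close>, then a set \<open>U\<close> meeting \<open>A\<close> accounts for a part of \<open>[0,1]\<close> that lies in an interval of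
  length \<open>2 C (diameter U)^s\<close>. The parts cover \<open>[0,1]\<close>, so these lengths add up to at least 1 and
  the \<open>s\<close>-dimensional weights of a cover stay above \<open>1 / (2 C)\<close>. Using a common index set for both
  maps avoids choosing a code for each point of \<open>A\<close>.
\<close>

lemma hausdorff_dim_ge_if_hoelder_onto_interval:
  fixes A :: "'a::metric_space set" and \<phi> :: "'i \<Rightarrow> 'a" and \<psi> :: "'i \<Rightarrow> real"
  assumes "0 < s" and "0 < C"
    and \<phi>: "\<phi> ` I \<subseteq> A" and \<psi>: "{0..1} \<subseteq> \<psi> ` I"
    and hoelder: "\<And>i j. i \<in> I \<Longrightarrow> j \<in> I \<Longrightarrow> \<bar>\<psi> i - \<psi> j\<bar> \<le> C * dist (\<phi> i) (\<phi> j) powr s"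
  shows "ereal s \<le> hausdorff_dim A"
proof (rule hausdorff_dim_geI)
  fix t :: real assume t: "0 \<le> t" "t < s"
  show "hausdorff_measure t A \<noteq> 0"
  proof
    assume "hausdorff_measure t A = 0"
    then have "hausdorff_premeasure t 1 A = 0"
      using hausdorff_premeasure_le_measure[of 1 t A] by simp
    then have "(INF U\<in>delta_covers 1 A. \<Sum>i. diam_power t (U i)) < ennreal (1 / (2 * C))"
      using \<open>0 < C\<close> by (simp add: hausdorff_premeasure_def)
    then obtain U where U: "U \<in> delta_covers 1 A"
      and small: "(\<Sum>i. diam_power t (U i)) < ennreal (1 / (2 * C))"
      by (auto simp: INF_less_iff)
    have bdd: "bounded (U n)" and diam: "diameter (U n) \<le> 1" for n
      using U by (auto simp: delta_covers_def)
    \<comment> \<open>\<open>B n\<close> is the interval that receives the numbers \<open>\<psi> i\<close> with \<open>\<phi> i \<in> U n\<close>, centred at one of them.\<close>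
    define J where "J n = {i \<in> I. \<phi> i \<in> U n}" for n
    define c where "c n = \<psi> (SOME i. i \<in> J n)" for n
    define r where "r n = C * diameter (U n) powr s" for n
    define B where "B n = (if J n = {} then {} else {c n - r n .. c n + r n})" for n
    have cover: "{0..1} \<subseteq> (\<Union>n. B n)"
    proof
      fix y :: real assume "y \<in> {0..1}"
      then obtain i where i: "i \<in> I" "y = \<psi> i" using \<psi> by auto
      then obtain n where n: "\<phi> i \<in> U n" using \<phi> U by (force simp: delta_covers_def)
      then have iJ: "i \<in> J n" using i by (simp add: J_def)
      then have some: "(SOME i. i \<in> J n) \<in> J n" by (rule someI)
      then have "\<bar>y - c n\<bar> \<le> C * dist (\<phi> i) (\<phi> (SOME i. i \<in> J n)) powr s"
        using hoelder i by (simp add: c_def J_def)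
      also have "\<dots> \<le> r n"
        unfolding r_def using \<open>0 < C\<close> \<open>0 < s\<close> some n bdd
        by (intro mult_left_mono powr_mono2 diameter_bounded_bound) (auto simp: J_def)
      finally have "y \<in> B n" using iJ by (auto simp: B_def abs_le_iff)
      then show "y \<in> (\<Union>n. B n)" by blast
    qed
    have measure_le: "emeasure lborel (B n) \<le> ennreal (2 * C) * diam_power t (U n)" for n
    proof (cases "J n = {}")
      case False
      then have "U n \<noteq> {}" by (auto simp: J_def)
      then have "ennreal (2 * r n) = ennreal (2 * C) * diam_power s (U n)"
        using \<open>0 < C\<close> \<open>0 < s\<close> by (simp add: r_def diam_power_def ennreal_mult[symmetric] mult.assoc)
      also have "\<dots> \<le> ennreal (2 * C) * diam_power t (U n)"
        using t bdd diam by (intro mult_left_mono diam_power_decreasing_exponent) auto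
      finally show ?thesis
        using False \<open>0 < C\<close> by (simp add: B_def r_def)
    qed (simp add: B_def)
    have sets: "range B \<subseteq> sets lborel"
      by (auto simp: B_def)
    have "emeasure lborel {0..1::real} \<le> emeasure lborel (\<Union>n. B n)"
      using cover sets by (intro emeasure_mono) auto
    also have "\<dots> \<le> (\<Sum>n. emeasure lborel (B n))"
      using sets by (rule emeasure_subadditive_countably)
    also have "\<dots> \<le> (\<Sum>n. ennreal (2 * C) * diam_power t (U n))"
      by (intro suminf_le measure_le) auto
    finally have "emeasure lborel {0..1::real} \<le> (\<Sum>n. ennreal (2 * C) * diam_power t (U n))" .
    then have "1 \<le> ennreal (2 * C) * (\<Sum>n. diam_power t (U n))"
      by simp
    also have "\<dots> < ennreal (2 * C) * ennreal (1 / (2 * C))"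
      using small \<open>0 < C\<close> by (intro ennreal_mult_strict_left_mono) auto
    also have "\<dots> = 1"
      using \<open>0 < C\<close> by (simp add: ennreal_mult[symmetric])
    finally show False by simp
  qed
qed

lemma hausdorff_premeasure_le_finite_cover:
  assumes "finite W" and "A \<subseteq> (\<Union>w\<in>W. V w)" and "0 \<le> \<delta>"
    and "\<And>w. w \<in> W \<Longrightarrow> bounded (V w) \<and> diameter (V w) \<le> \<delta>"
  shows "hausdorff_premeasure s \<delta> A \<le> (\<Sum>w\<in>W. diam_power s (V w))"
proof -
  obtain h where h: "bij_betw h {0..<card W} W"
    using ex_bij_betw_nat_finite[OF \<open>finite W\<close>] by blast
  define U where "U i = (if i < card W then V (h i) else {})" for i
  have "A \<subseteq> (\<Union>i. U i)"
  proof
    fix p assume "p \<in> A"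
    then obtain w where w: "w \<in> W" "p \<in> V w" using assms(2) by blast
    then obtain i where "i < card W" "w = h i"
      using bij_betw_imp_surj_on[OF h] by (metis atLeastLessThan_iff imageE)
    then have "p \<in> U i" using w by (simp add: U_def)
    then show "p \<in> (\<Union>i. U i)" by blast
  qed
  moreover have "bounded (U i) \<and> diameter (U i) \<le> \<delta>" for i
    using assms bij_betw_apply[OF h, of i] by (auto simp: U_def)
  ultimately have "U \<in> delta_covers \<delta> A" by (auto simp: delta_covers_def)
  then have "hausdorff_premeasure s \<delta> A \<le> (\<Sum>i. diam_power s (U i))"
    unfolding hausdorff_premeasure_def by (rule INF_lower)
  also have "\<dots> = (\<Sum>i\<in>{0..<card W}. diam_power s (U i))"
    by (intro suminf_finite) (auto simp: U_def diam_power_def)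
  also have "\<dots> = (\<Sum>i\<in>{0..<card W}. diam_power s (V (h i)))"
    by (intro sum.cong) (auto simp: U_def)
  also have "\<dots> = (\<Sum>w\<in>W. diam_power s (V w))"
    by (rule sum.reindex_bij_betw[OF h])
  finally show ?thesis .
qed

text \<open>
  The exponent \<open>log m / (- log a)\<close> is the one at which the \<open>m^n\<close> words of length \<open>n\<close>, each
  contributing diameter \<open>a^n\<close>, have total weight 1.
\<close>

lemma power_powr_similarity_dim:
  fixes a :: real
  assumes "0 < a" "a < 1" "0 < m"
  shows "(a ^ n) powr (ln (real m) / (- ln a)) = (1 / real m) ^ n"
proof -
  have "ln a \<noteq> 0" using assms by auto
  then have "a powr (ln (real m) / (- ln a)) = 1 / real m"
    using assms by (simp add: powr_def exp_minus inverse_eq_divide)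
  moreover have "(a ^ n) powr (ln (real m) / (- ln a)) = (a powr (ln (real m) / (- ln a))) ^ n"
    using assms by (simp add: powr_power powr_powr powr_realpow[symmetric] mult.commute)
  ultimately show ?thesis by simp
qed

text \<open>
  Upper bounds come from the cover by the \<open>m^n\<close> sets of points that share the first \<open>n\<close> symbols of
  their codes. Above the critical exponent their total weight decays geometrically in \<open>n\<close>.
\<close>

lemma hausdorff_dim_le_if_coded:
  fixes A :: "'a::metric_space set" and \<kappa> :: "'a \<Rightarrow> nat \<Rightarrow> nat"
  assumes "2 \<le> m" and b: "0 < b" "b < 1" and "0 < C"
    and code: "\<And>p i. p \<in> A \<Longrightarrow> \<kappa> p i < m"
    and near: "\<And>n p q. p \<in> A \<Longrightarrow> q \<in> A \<Longrightarrow> (\<And>i. i < n \<Longrightarrow> \<kappa> p i = \<kappa> q i)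
      \<Longrightarrow> dist p q \<le> C * b ^ n"
  shows "hausdorff_dim A \<le> ereal (ln (real m) / (- ln b))"
proof (rule hausdorff_dim_leI)
  let ?s = "ln (real m) / (- ln b)"
  have "ln b < 0" using b by simp
  then show s: "0 \<le> ?s" using \<open>2 \<le> m\<close> by (intro divide_nonneg_pos) auto
  fix t assume t: "?s < t"
  then have "0 < t" using s by linarith
  \<comment> \<open>The total weight of the cover by words of length \<open>n\<close> is at most \<open>C^t \<theta>^n\<close>.\<close>
  define \<theta> where "\<theta> = b powr (t - ?s)"
  have \<theta>: "0 < \<theta>" "\<theta> < 1"
    using b t powr_less_mono'[of b 0 "t - ?s"] by (auto simp: \<theta>_def)
  have premeasure: "hausdorff_premeasure t \<delta> A \<le> ennreal (C powr t * \<theta> ^ n)"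
    if n: "C * b ^ n \<le> \<delta>" for n \<delta>
  proof -
    define W where "W = Pi\<^sub>E {..<n} (\<lambda>_. {..<m})"
    define V where "V w = {p \<in> A. restrict (\<kappa> p) {..<n} = w}" for w
    have W: "finite W" "card W = m ^ n"
      by (simp_all add: W_def finite_PiE card_PiE)
    have cover: "A \<subseteq> (\<Union>w\<in>W. V w)"
      using code by (force simp: V_def W_def)
    have dist: "dist p q \<le> C * b ^ n" if "p \<in> V w" "q \<in> V w" for w p q
    proof (rule near)
      fix i assume "i < n"
      have "restrict (\<kappa> p) {..<n} i = restrict (\<kappa> q) {..<n} i"
        using that by (simp add: V_def)
      then show "\<kappa> p i = \<kappa> q i" using \<open>i < n\<close> by simp
    qed (use that in \<open>auto simp: V_def\<close>)
    have bdd: "bounded (V w)" for w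
      using dist by (auto simp: bounded_two_points)
    have diam: "diameter (V w) \<le> C * b ^ n" for w
      unfolding diameter_def using dist \<open>0 < C\<close> b by (auto intro!: cSUP_least)
    have "hausdorff_premeasure t \<delta> A \<le> (\<Sum>w\<in>W. diam_power t (V w))"
      using W cover bdd diam n \<open>0 < C\<close> b
      by (intro hausdorff_premeasure_le_finite_cover) (auto intro: order.trans order.trans[rotated])
    also have "\<dots> \<le> (\<Sum>w\<in>W. ennreal ((C * b ^ n) powr t))"
      using diam bdd \<open>0 < t\<close>
      by (intro sum_mono) (auto simp: diam_power_def intro!: ennreal_leI powr_mono2 diameter_ge_0)
    also have "\<dots> = ennreal (real m ^ n * (C * b ^ n) powr t)"
      using W by (simp add: ennreal_mult ennreal_power ennreal_of_nat_eq_real_of_nat)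
    also have "(C * b ^ n) powr t = C powr t * ((b ^ n) powr ?s * (b ^ n) powr (t - ?s))"
      using \<open>0 < C\<close> b by (simp add: powr_mult powr_add[symmetric])
    also have "(b ^ n) powr ?s = (1 / real m) ^ n"
      using b \<open>2 \<le> m\<close> by (intro power_powr_similarity_dim) auto
    also have "(b ^ n) powr (t - ?s) = \<theta> ^ n"
      unfolding \<theta>_def using b by (simp add: powr_power powr_powr powr_realpow[symmetric] mult.commute)
    also have "real m ^ n * (C powr t * ((1 / real m) ^ n * \<theta> ^ n)) = C powr t * \<theta> ^ n"
      using \<open>2 \<le> m\<close> by (simp add: power_divide)
    finally show ?thesis .
  qed
  have "hausdorff_premeasure t \<delta> A \<le> 0" if "0 < \<delta>" for \<delta>
  proof (rule tendsto_lowerbound)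
    have "(\<lambda>n. C powr t * \<theta> ^ n) \<longlonglongrightarrow> C powr t * 0"
      using \<theta> by (intro tendsto_intros LIMSEQ_realpow_zero) auto
    then have "(\<lambda>n. ennreal (C powr t * \<theta> ^ n)) \<longlonglongrightarrow> ennreal (C powr t * 0)"
      by (rule tendsto_ennrealI)
    then show "(\<lambda>n. ennreal (C powr t * \<theta> ^ n)) \<longlonglongrightarrow> 0" by simp
    have "(\<lambda>n. C * b ^ n) \<longlonglongrightarrow> C * 0"
      using b by (intro tendsto_intros LIMSEQ_realpow_zero) auto
    then have "eventually (\<lambda>n. C * b ^ n < \<delta>) sequentially"
      using \<open>0 < \<delta>\<close> by (intro order_tendstoD(2)) auto
    then show "eventually (\<lambda>n. hausdorff_premeasure t \<delta> A \<le> ennreal (C powr t * \<theta> ^ n)) sequentially"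
      by eventually_elim (rule premeasure, auto)
  qed simp
  then show "hausdorff_measure t A = 0"
    unfolding hausdorff_measure_def by (auto simp: SUP_eq_iff intro!: antisym SUP_least)
qed

section \<open>Digit expansions\<close>

definition digit_seqs :: "nat \<Rightarrow> (nat \<Rightarrow> nat) set" where
  "digit_seqs m = {d. \<forall>i. d i < m}"

definition expansion :: "real \<Rightarrow> (nat \<Rightarrow> nat) \<Rightarrow> real" where
  "expansion l d = (\<Sum>i. real (d i) * l ^ Suc i)"

lemma digit_le:
  assumes "d \<in> digit_seqs m"
  shows "real (d i) \<le> real m - 1"
proof -
  have "d i < m" using assms by (simp add: digit_seqs_def)
  then show ?thesis by linarith
qed

lemma digit_seqs_shift: "d \<in> digit_seqs m \<Longrightarrow> (\<lambda>i. d (i + n)) \<in> digit_seqs m"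
  by (simp add: digit_seqs_def)

lemma summable_expansion:
  assumes "d \<in> digit_seqs m" "0 \<le> l" "l < 1"
  shows "summable (\<lambda>i. real (d i) * l ^ Suc i)"
proof (rule summable_comparison_test')
  show "summable (\<lambda>i. (real m - 1) * l * l ^ i)"
    using assms by (intro summable_mult summable_geometric) auto
  show "norm (real (d i) * l ^ Suc i) \<le> (real m - 1) * l * l ^ i" for i
    using mult_right_mono[OF digit_le[OF assms(1), of i], of "l * l ^ i"] assms
    by (simp add: abs_mult mult.assoc)
qed

lemma expansion_nonneg:
  assumes "d \<in> digit_seqs m" "0 \<le> l" "l < 1"
  shows "0 \<le> expansion l d"
  unfolding expansion_def using assms by (intro suminf_nonneg summable_expansion) auto

lemma expansion_le:
  assumes "d \<in> digit_seqs m" "0 \<le> l" "l < 1"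
  shows "expansion l d \<le> (real m - 1) * l / (1 - l)"
proof -
  have "expansion l d \<le> (\<Sum>i. (real m - 1) * l * l ^ i)"
    unfolding expansion_def
  proof (intro suminf_le summable_expansion summable_mult summable_geometric)
    show "real (d i) * l ^ Suc i \<le> (real m - 1) * l * l ^ i" for i
      using mult_right_mono[OF digit_le[OF assms(1), of i], of "l * l ^ i"] assms
      by (simp add: mult.assoc)
  qed (use assms in auto)
  also have "\<dots> = (real m - 1) * l / (1 - l)"
    using assms by (subst suminf_mult) (auto simp: suminf_geometric summable_geometric)
  finally show ?thesis .
qed

lemma expansion_split:
  assumes "d \<in> digit_seqs m" "0 \<le> l" "l < 1"
  shows "expansion l d = (\<Sum>i<n. real (d i) * l ^ Suc i) + l ^ n * expansion l (\<lambda>i. d (i + n))"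
proof -
  have "expansion l d = (\<Sum>i. real (d (i + n)) * l ^ Suc (i + n)) + (\<Sum>i<n. real (d i) * l ^ Suc i)"
    unfolding expansion_def by (rule suminf_split_initial_segment[OF summable_expansion[OF assms]])
  also have "(\<lambda>i. real (d (i + n)) * l ^ Suc (i + n)) = (\<lambda>i. l ^ n * (real (d (i + n)) * l ^ Suc i))"
    by (simp add: power_add ac_simps)
  also have "(\<Sum>i. l ^ n * (real (d (i + n)) * l ^ Suc i)) = l ^ n * expansion l (\<lambda>i. d (i + n))"
    unfolding expansion_def using assms
    by (intro suminf_mult summable_expansion digit_seqs_shift)
  finally show ?thesis by simp
qed

lemma ratio_less_one:
  assumes "2 \<le> m" "l \<le> 1 / real m"
  shows "l < 1" and "l \<le> 1 / 2" and "real m * l \<le> 1"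
proof -
  have "1 / real m \<le> 1 / 2" using assms(1) by (simp add: field_simps)
  then show "l \<le> 1 / 2" using assms(2) by linarith
  then show "l < 1" by simp
  show "real m * l \<le> 1" using assms by (simp add: field_simps)
qed

lemma expansion_le_mult_ratio:
  assumes "2 \<le> m" "d \<in> digit_seqs m" "0 \<le> l" "l \<le> 1 / real m"
  shows "expansion l d \<le> real m * l"
proof -
  note l = ratio_less_one[OF assms(1,4)]
  have "real m * l * l \<le> 1 * l" using l assms by (intro mult_right_mono) auto
  then have "(real m - 1) * l \<le> real m * l * (1 - l)" by (simp add: algebra_simps)
  then have "(real m - 1) * l / (1 - l) \<le> real m * l" using l by (simp add: pos_divide_le_eq)
  then show ?thesis using expansion_le[OF assms(2,3)] l by linarith
qed

text \<open>
  For \<open>l \<le> 1/m\<close> all expansions lie in \<open>[0,1]\<close>, hence the tails after position \<open>n\<close> lie in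
  \<open>[0, l^n]\<close>.
\<close>

lemma expansion_agree:
  assumes "2 \<le> m" "d \<in> digit_seqs m" "e \<in> digit_seqs m" "0 \<le> l" "l \<le> 1 / real m"
    and agree: "\<And>i. i < n \<Longrightarrow> d i = e i"
  shows "\<bar>expansion l d - expansion l e\<bar> \<le> l ^ n"
proof -
  note l = ratio_less_one[OF assms(1,5)]
  have bounds: "0 \<le> expansion l (\<lambda>i. f (i + n)) \<and> expansion l (\<lambda>i. f (i + n)) \<le> 1"
    if "f \<in> digit_seqs m" for f
    using expansion_nonneg[OF digit_seqs_shift[OF that]] l assms
      expansion_le_mult_ratio[OF assms(1) digit_seqs_shift[OF that, of n] assms(4,5)]
    by (metis order.trans)
  have "expansion l d - expansion l e
      = l ^ n * (expansion l (\<lambda>i. d (i + n)) - expansion l (\<lambda>i. e (i + n)))"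
    using expansion_split[OF assms(2,4) l(1), of n] expansion_split[OF assms(3,4) l(1), of n] agree
    by (simp add: algebra_simps)
  then have "\<bar>expansion l d - expansion l e\<bar>
      = l ^ n * \<bar>expansion l (\<lambda>i. d (i + n)) - expansion l (\<lambda>i. e (i + n))\<bar>"
    using assms(4) by (simp add: abs_mult)
  also have "\<dots> \<le> l ^ n * 1"
    using bounds[OF assms(2)] bounds[OF assms(3)] assms(4) by (intro mult_left_mono) auto
  finally show ?thesis by simp
qed

text \<open>
  One unit in the first differing digit is worth \<open>l^(n+1)\<close>, and the later digits can make up for
  at most the fraction \<open>(m-1) l / (1-l)\<close> of it. Below the ratio \<open>1/m\<close> that fraction is less than
  1. It is bounded at \<open>b\<close> so that one constant serves all ratios in a range.
\<close>

lemma expansion_gap: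
  assumes "d \<in> digit_seqs m" "e \<in> digit_seqs m" "0 \<le> l" "l \<le> b" "b < 1"
    and agree: "\<And>i. i < n \<Longrightarrow> d i = e i" and "e n < d n"
  shows "l ^ Suc n * (1 - (real m - 1) * b / (1 - b)) \<le> expansion l d - expansion l e"
proof -
  have l: "l < 1" using assms by simp
  have m: "1 \<le> m" using assms by (cases m) (auto simp: digit_seqs_def)
  have "(real m - 1) * l / (1 - l) \<le> (real m - 1) * b / (1 - b)"
    using assms m by (intro frac_le mult_left_mono) auto
  then have tail: "expansion l (\<lambda>i. e (i + Suc n)) \<le> (real m - 1) * b / (1 - b)"
    using expansion_le[OF digit_seqs_shift[OF assms(2), of "Suc n"] assms(3) l] by linarith
  have "1 * l ^ Suc n \<le> (real (d n) - real (e n)) * l ^ Suc n"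
    using assms by (intro mult_right_mono) auto
  moreover have "0 \<le> l ^ Suc n * expansion l (\<lambda>i. d (i + Suc n))"
    using expansion_nonneg[OF digit_seqs_shift[OF assms(1), of "Suc n"] assms(3) l] assms by simp
  moreover have "l ^ Suc n * expansion l (\<lambda>i. e (i + Suc n)) \<le> l ^ Suc n * ((real m - 1) * b / (1 - b))"
    using tail assms by (intro mult_left_mono) auto
  moreover have "expansion l d - expansion l e = (real (d n) - real (e n)) * l ^ Suc n
      + l ^ Suc n * expansion l (\<lambda>i. d (i + Suc n)) - l ^ Suc n * expansion l (\<lambda>i. e (i + Suc n))"
    using expansion_split[OF assms(1,3) l, of "Suc n"] expansion_split[OF assms(2,3) l, of "Suc n"] agree
    by (simp add: left_diff_distrib)
  ultimately show ?thesis by (simp only: right_diff_distrib mult_1 mult_1_right)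
qed

lemma gap_constant_pos:
  assumes "2 \<le> m" "b < 1 / real m"
  shows "0 < 1 - (real m - 1) * b / (1 - b)"
proof -
  have "b < 1" using ratio_less_one[of m b] assms by simp
  moreover have "real m * b < 1" using assms by (simp add: field_simps)
  ultimately show ?thesis by (simp add: field_simps)
qed

text \<open>
  A single nonzero digit already forces this growth, because all other terms are nondecreasing in
  the ratio. It turns information about expansion values into information about ratios.
\<close>

lemma expansion_increasing:
  assumes "d \<in> digit_seqs m" "0 \<le> u" "u \<le> v" "v < 1" "1 \<le> d k"
  shows "u ^ k * (v - u) \<le> expansion v d - expansion u d"
proof -
  have u: "u < 1" using assms by simp
  have S: "summable (\<lambda>i. real (d i) * v ^ Suc i)" "summable (\<lambda>i. real (d i) * u ^ Suc i)"
    using assms u by (auto intro!: summable_expansion simp del: power_Suc)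
  have nn: "0 \<le> real (d i) * v ^ Suc i - real (d i) * u ^ Suc i" for i
    using assms power_mono[of u v "Suc i"] by (simp add: mult_left_mono del: power_Suc)
  have "u ^ k * v \<le> v ^ k * v"
    using assms by (intro mult_right_mono power_mono) auto
  then have "u ^ k * (v - u) \<le> 1 * (v ^ Suc k - u ^ Suc k)"
    by (simp add: algebra_simps)
  also have "\<dots> \<le> real (d k) * (v ^ Suc k - u ^ Suc k)"
    using assms power_mono[of u v "Suc k"] by (intro mult_right_mono) (auto simp del: power_Suc)
  also have "\<dots> = (\<Sum>i\<in>{k}. real (d i) * v ^ Suc i - real (d i) * u ^ Suc i)"
    by (simp add: right_diff_distrib)
  also have "\<dots> \<le> (\<Sum>i. real (d i) * v ^ Suc i - real (d i) * u ^ Suc i)"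
    using nn by (intro sum_le_suminf summable_diff S) auto
  also have "\<dots> = expansion v d - expansion u d"
    unfolding expansion_def by (rule suminf_diff[symmetric, OF S])
  finally show ?thesis .
qed

text \<open>
  The constant is the derivative of the geometric series at \<open>b\<close>, times a bound for the digits.
\<close>

lemma expansion_lipschitz:
  assumes "d \<in> digit_seqs m" "0 \<le> u" "u \<le> b" "0 \<le> v" "v \<le> b" "b < 1"
  shows "\<bar>expansion u d - expansion v d\<bar> \<le> real m / (1 - b)\<^sup>2 * \<bar>u - v\<bar>"
proof -
  have S: "summable (\<lambda>i. real (d i) * u ^ Suc i)" "summable (\<lambda>i. real (d i) * v ^ Suc i)"
    using assms by (auto intro!: summable_expansion simp del: power_Suc)
  have G: "(\<lambda>i. real (Suc i) * b ^ i) sums (1 / (1 - b)\<^sup>2)"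
    using geometric_deriv_sums[of b] assms by simp
  have G': "(\<lambda>i. real m * \<bar>u - v\<bar> * (real (Suc i) * b ^ i)) sums (real m * \<bar>u - v\<bar> * (1 / (1 - b)\<^sup>2))"
    by (rule sums_mult[OF G])
  have termwise: "norm (real (d i) * u ^ Suc i - real (d i) * v ^ Suc i)
      \<le> real m * \<bar>u - v\<bar> * (real (Suc i) * b ^ i)" for i
  proof -
    have "norm (u ^ Suc i - v ^ Suc i) \<le> real (Suc i) * b ^ i * \<bar>u - v\<bar>"
    proof -
      have "u ^ Suc i - v ^ Suc i = (u - v) * (\<Sum>p<Suc i. u ^ p * v ^ (i - p))"
        by (rule diff_power_eq_sum)
      moreover have "norm (\<Sum>p<Suc i. u ^ p * v ^ (i - p)) \<le> (\<Sum>p<Suc i. b ^ i)"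
      proof (rule order.trans[OF norm_sum], rule sum_mono)
        fix p assume "p \<in> {..<Suc i}"
        have "u ^ p * v ^ (i - p) \<le> b ^ p * b ^ (i - p)"
          using assms by (intro mult_mono power_mono) auto
        also have "\<dots> = b ^ i" using \<open>p \<in> _\<close> by (simp add: power_add[symmetric])
        finally show "norm (u ^ p * v ^ (i - p)) \<le> b ^ i" using assms by simp
      qed
      ultimately show ?thesis
        by (simp add: abs_mult mult.commute mult_left_mono del: power_Suc)
    qed
    moreover have "real (d i) \<le> real m" using digit_le[OF assms(1), of i] by simp
    ultimately have "real (d i) * norm (u ^ Suc i - v ^ Suc i) \<le> real m * (real (Suc i) * b ^ i * \<bar>u - v\<bar>)"
      by (intro mult_mono) auto
    then show ?thesis
      by (simp add: right_diff_distrib[symmetric] abs_mult ac_simps del: power_Suc)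
  qed
  have "expansion u d - expansion v d = (\<Sum>i. real (d i) * u ^ Suc i - real (d i) * v ^ Suc i)"
    unfolding expansion_def by (rule suminf_diff[OF S])
  also have "norm \<dots> \<le> (\<Sum>i. real m * \<bar>u - v\<bar> * (real (Suc i) * b ^ i))"
    using termwise sums_summable[OF G'] by (rule norm_suminf_le)
  also have "\<dots> = real m * \<bar>u - v\<bar> * (1 / (1 - b)\<^sup>2)"
    using sums_unique[OF G'] by simp
  finally show ?thesis by simp
qed

lemma expansion_root:
  assumes "2 \<le> m" "d \<in> digit_seqs m" "0 \<le> a" "a \<le> b" "b \<le> 1 / real m"
    and "expansion a d \<le> x" "x \<le> expansion b d"
  obtains u where "a \<le> u" "u \<le> b" "expansion u d = x"
proof -
  have b: "b < 1" using ratio_less_one assms by blast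
  have "continuous_on {a..b} (\<lambda>u. expansion u d)"
  proof (rule lipschitz_on_continuous_on)
    show "(real m / (1 - b)\<^sup>2)-lipschitz_on {a..b} (\<lambda>u. expansion u d)"
    proof (rule lipschitz_onI)
      fix u v assume "u \<in> {a..b}" "v \<in> {a..b}"
      then show "dist (expansion u d) (expansion v d) \<le> real m / (1 - b)\<^sup>2 * dist u v"
        unfolding dist_real_def using assms b by (intro expansion_lipschitz) auto
    qed (use b in simp)
  qed
  then show thesis
    using IVT'[of "\<lambda>u. expansion u d" a x b] assms that by auto
qed

text \<open>
  The partial sums are \<open>\<lfloor>y m^n\<rfloor> / m^n\<close>, by telescoping from \<open>\<lfloor>y\<rfloor> = 0\<close>. At \<open>y = 1\<close> this start fails,
  and the constant sequence \<open>m - 1\<close> is used.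
\<close>

lemma ex_base_expansion:
  assumes "2 \<le> m" "y \<in> {0..1}"
  obtains d where "d \<in> digit_seqs m" "expansion (1 / real m) d = y"
proof (cases "y = 1")
  case True
  have "(\<lambda>i. (real m - 1) / real m * (1 / real m) ^ i) sums ((real m - 1) / real m * (1 / (1 - 1 / real m)))"
    using assms by (intro sums_mult geometric_sums) auto
  then have "(\<lambda>i. real (m - 1) * (1 / real m) ^ Suc i) sums 1"
    using assms by (simp add: of_nat_diff field_simps)
  then have "expansion (1 / real m) (\<lambda>_. m - 1) = 1"
    by (simp add: expansion_def sums_iff)
  moreover have "(\<lambda>_. m - 1) \<in> digit_seqs m" using assms by (simp add: digit_seqs_def)
  ultimately show thesis using that True by blast
next
  case False
  then have y: "0 \<le> y" "y < 1" using assms by auto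
  have m: "0 < real m" using assms by simp
  define q where "q i = \<lfloor>y * real m ^ i\<rfloor>" for i
  have q: "real_of_int (q i) \<le> y * real m ^ i" "y * real m ^ i < real_of_int (q i) + 1" for i
    unfolding q_def by linarith+
  define d where "d i = nat (q (Suc i) - int m * q i)" for i
  have range: "0 \<le> q (Suc i) - int m * q i \<and> q (Suc i) - int m * q i < int m" for i
  proof -
    have "real m * real_of_int (q i) \<le> real m * (y * real m ^ i)"
      using q(1)[of i] m by (intro mult_left_mono) auto
    then have "real_of_int (int m * q i) < real_of_int (q (Suc i) + 1)"
      using q(2)[of "Suc i"] by (simp add: ac_simps)
    moreover have "real m * (y * real m ^ i) < real m * (real_of_int (q i) + 1)"
      using q(2)[of i] m by (intro mult_strict_left_mono) auto
    then have "real_of_int (q (Suc i)) < real_of_int (int m * (q i + 1))"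
      using q(1)[of "Suc i"] by (simp add: ac_simps)
    ultimately show ?thesis by (simp only: of_int_less_iff) (simp add: algebra_simps)
  qed
  have dig: "d \<in> digit_seqs m"
    using range by (auto simp: digit_seqs_def d_def nat_less_iff)
  have partial: "(\<Sum>i<n. real (d i) * (1 / real m) ^ Suc i) = real_of_int (q n) / real m ^ n" for n
  proof (induction n)
    case 0
    then show ?case using y by (simp add: q_def floor_eq_iff)
  next
    case (Suc n)
    have "real (d n) = real_of_int (q (Suc n)) - real m * real_of_int (q n)"
      unfolding d_def using range[of n] by (simp add: of_nat_nat)
    then show ?case using Suc m by (simp add: field_simps)
  qed
  have "(\<lambda>n. real_of_int (q n) / real m ^ n) \<longlonglongrightarrow> y"
  proof (rule tendsto_sandwich)
    show "eventually (\<lambda>n. y - (1 / real m) ^ n \<le> real_of_int (q n) / real m ^ n) sequentially"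
    proof (intro always_eventually allI)
      fix n
      have "(y * real m ^ n - 1) / real m ^ n \<le> real_of_int (q n) / real m ^ n"
        using q(2)[of n] m by (intro divide_right_mono) auto
      then show "y - (1 / real m) ^ n \<le> real_of_int (q n) / real m ^ n"
        using m by (simp add: diff_divide_distrib power_divide)
    qed
    show "eventually (\<lambda>n. real_of_int (q n) / real m ^ n \<le> y) sequentially"
      using q(1) m by (intro always_eventually allI) (simp add: pos_divide_le_eq)
    have "(\<lambda>n. (1 / real m) ^ n) \<longlonglongrightarrow> 0"
      using assms by (intro LIMSEQ_realpow_zero) auto
    from tendsto_diff[OF tendsto_const this, of y]
    show "(\<lambda>n. y - (1 / real m) ^ n) \<longlonglongrightarrow> y" by simp
  qed simp
  then have "(\<lambda>i. real (d i) * (1 / real m) ^ Suc i) sums y"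
    unfolding sums_def partial .
  then have "expansion (1 / real m) d = y" by (simp add: expansion_def sums_iff)
  then show thesis using dig that by blast
qed

text \<open>
  The converse principle for sets that are indexed by all digit sequences. Mapping the point \<open>\<phi> d\<close>
  to the number with base \<open>m\<close> digits \<open>d\<close> covers \<open>[0,1]\<close>, and it is Hoelder: two sequences that
  first differ at position \<open>n\<close> give numbers at distance at most \<open>m^-n\<close>, which is a constant times
  the critical power of the separation \<open>c a^n\<close>.
\<close>

lemma hausdorff_dim_ge_if_separated:
  fixes A :: "'a::metric_space set" and \<phi> :: "(nat \<Rightarrow> nat) \<Rightarrow> 'a"
  assumes "2 \<le> m" "0 < a" "a < 1" "0 < c" and \<phi>: "\<phi> ` digit_seqs m \<subseteq> A"
    and sep: "\<And>n d e. d \<in> digit_seqs m \<Longrightarrow> e \<in> digit_seqs m \<Longrightarrow> (\<And>i. i < n \<Longrightarrow> d i = e i)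
      \<Longrightarrow> e n < d n \<Longrightarrow> c * a ^ n \<le> dist (\<phi> d) (\<phi> e)"
  shows "ereal (ln (real m) / (- ln a)) \<le> hausdorff_dim A"
proof (rule hausdorff_dim_ge_if_hoelder_onto_interval[OF _ _ \<phi>])
  let ?s = "ln (real m) / (- ln a)"
  show s: "0 < ?s" using assms by (intro divide_pos_pos) auto
  show "0 < c powr (- ?s)" using \<open>0 < c\<close> by simp
  show "{0..1} \<subseteq> expansion (1 / real m) ` digit_seqs m"
    using ex_base_expansion[OF \<open>2 \<le> m\<close>] by blast
  have main: "\<bar>expansion (1 / real m) d - expansion (1 / real m) e\<bar> \<le> c powr (- ?s) * dist (\<phi> d) (\<phi> e) powr ?s"
    if de: "d \<in> digit_seqs m" "e \<in> digit_seqs m" and n: "\<And>i. i < n \<Longrightarrow> d i = e i" "e n < d n" for d e n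
  proof -
    have "\<bar>expansion (1 / real m) d - expansion (1 / real m) e\<bar> \<le> (1 / real m) ^ n"
      using assms(1) de n(1) by (intro expansion_agree) auto
    also have "\<dots> = c powr (- ?s) * (c * a ^ n) powr ?s"
      using assms power_powr_similarity_dim[of a m n]
      by (simp add: powr_mult powr_minus field_simps)
    also have "\<dots> \<le> c powr (- ?s) * dist (\<phi> d) (\<phi> e) powr ?s"
      using sep[OF de n] s assms by (intro mult_left_mono powr_mono2) auto
    finally show ?thesis .
  qed
  fix d e assume de: "d \<in> digit_seqs m" "e \<in> digit_seqs m"
  show "\<bar>expansion (1 / real m) d - expansion (1 / real m) e\<bar> \<le> c powr (- ?s) * dist (\<phi> d) (\<phi> e) powr ?s"
  proof (cases "d = e")
    case False
    then obtain j where "d j \<noteq> e j" by auto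
    define n where "n = (LEAST i. d i \<noteq> e i)"
    have "d n \<noteq> e n" unfolding n_def by (rule LeastI[of _ j]) fact
    moreover have agree: "d i = e i" if "i < n" for i
      using not_less_Least[of i "\<lambda>i. d i \<noteq> e i"] that by (auto simp: n_def)
    ultimately consider "e n < d n" | "d n < e n" by linarith
    then show ?thesis
    proof cases
      case 1
      then show ?thesis using main[OF de agree] by blast
    next
      case 2
      then show ?thesis using main[OF de(2,1), of n] agree
        by (simp add: abs_minus_commute dist_commute)
    qed
  qed simp
qed

section \<open>The self-similar sets\<close>

lemma K_set_eq_expansions:
  assumes "2 \<le> m" "0 \<le> l" "l < 1"
  shows "K_set m l = expansion l ` digit_seqs m"
proof (intro equalityI subsetI)
  fix y assume "y \<in> K_set m l"
  then obtain d where d: "\<forall>i\<ge>1. d i \<in> {0..m - 1}" "(\<lambda>i. real (d (Suc i)) * l ^ Suc i) sums y"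
    by (auto simp: K_set_def)
  have "d (Suc i) < m" for i
    using d(1)[rule_format, of "Suc i"] assms by auto
  then have "(\<lambda>i. d (Suc i)) \<in> digit_seqs m" by (simp add: digit_seqs_def)
  moreover have "y = expansion l (\<lambda>i. d (Suc i))"
    using d(2) by (simp add: expansion_def sums_iff)
  ultimately show "y \<in> expansion l ` digit_seqs m" by blast
next
  fix y assume "y \<in> expansion l ` digit_seqs m"
  then obtain d where d: "d \<in> digit_seqs m" "y = expansion l d" by blast
  have "(\<lambda>i. real (d i) * l ^ Suc i) sums y"
    unfolding d(2) expansion_def using summable_expansion[OF d(1) assms(2,3)] by (rule summable_sums)
  moreover have "d i \<le> m - 1" for i
  proof -
    have "d i < m" using d(1) by (simp add: digit_seqs_def)
    then show ?thesis by simp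
  qed
  ultimately show "y \<in> K_set m l"
    unfolding K_set_def by (auto intro!: exI[of _ "\<lambda>i. d (i - 1)"])
qed

text \<open>
  Coding by digits gives the upper bound and, for \<open>l < 1/m\<close>, the gaps give the lower one. At
  \<open>l = 1/m\<close> the gaps close up, but the set then contains \<open>[0,1]\<close> itself.
\<close>

lemma hausdorff_dim_K_set:
  assumes "2 \<le> m" "0 < l" "l \<le> 1 / real m"
  shows "hausdorff_dim (K_set m l) = ereal (ln (real m) / (- ln l))"
proof (rule antisym)
  have l: "l < 1" using ratio_less_one assms by blast
  have K: "K_set m l = expansion l ` digit_seqs m"
    using K_set_eq_expansions assms l by simp
  have "\<forall>p\<in>K_set m l. \<exists>d. d \<in> digit_seqs m \<and> expansion l d = p" unfolding K by blast
  from bchoice[OF this]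
  obtain \<kappa> where \<kappa>: "\<forall>p\<in>K_set m l. \<kappa> p \<in> digit_seqs m \<and> expansion l (\<kappa> p) = p"
    by blast
  show "hausdorff_dim (K_set m l) \<le> ereal (ln (real m) / (- ln l))"
  proof (rule hausdorff_dim_le_if_coded[where \<kappa> = \<kappa> and C = 1])
    show "\<kappa> p i < m" if "p \<in> K_set m l" for p i
      using \<kappa> that by (auto simp: digit_seqs_def)
    show "dist p q \<le> 1 * l ^ n"
      if "p \<in> K_set m l" "q \<in> K_set m l" "\<And>i. i < n \<Longrightarrow> \<kappa> p i = \<kappa> q i" for n p q
      using \<kappa> that assms expansion_agree[of m "\<kappa> p" "\<kappa> q" l n] by (simp add: dist_real_def)
  qed (use assms l in auto)
  show "ereal (ln (real m) / (- ln l)) \<le> hausdorff_dim (K_set m l)"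
  proof (cases "l = 1 / real m")
    case True
    have "ereal 1 \<le> hausdorff_dim (K_set m l)"
    proof (rule hausdorff_dim_ge_if_hoelder_onto_interval[where \<phi> = "expansion l" and \<psi> = "expansion l"
          and C = 1 and I = "digit_seqs m"])
      show "{0..1} \<subseteq> expansion l ` digit_seqs m"
        unfolding True using ex_base_expansion[OF \<open>2 \<le> m\<close>] by blast
    qed (auto simp: K dist_real_def)
    then show ?thesis using True assms by (simp add: ln_div)
  next
    case False
    define \<gamma> where "\<gamma> = 1 - (real m - 1) * l / (1 - l)"
    have gap: "0 < \<gamma>"
      unfolding \<gamma>_def using assms False by (intro gap_constant_pos) auto
    show ?thesis
    proof (rule hausdorff_dim_ge_if_separated[where \<phi> = "expansion l"
          and c = "l * \<gamma>"])
      fix n d e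
      assume "d \<in> digit_seqs m" "e \<in> digit_seqs m" "\<And>i. i < n \<Longrightarrow> d i = e i" "e n < d n"
      then have "l ^ Suc n * (1 - (real m - 1) * l / (1 - l)) \<le> expansion l d - expansion l e"
        using assms l by (intro expansion_gap) auto
      then have "l ^ Suc n * \<gamma> \<le> dist (expansion l d) (expansion l e)"
        unfolding \<gamma>_def dist_real_def by linarith
      then show "l * \<gamma> * l ^ n \<le> dist (expansion l d) (expansion l e)"
        by (simp add: mult.assoc mult.commute mult.left_commute)
    next
      show "0 < l * \<gamma>" using assms gap by simp
      show "expansion l ` digit_seqs m \<subseteq> K_set m l" unfolding K ..
    qed (use assms l in auto)
  qed
qed

section \<open>The parameter set\<close>

lemma Lambda_setE:
  assumes "2 \<le> m" "l \<in> Lambda_set m x"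
  obtains d where "0 < l" "l \<le> 1 / real m" "d \<in> digit_seqs m" "expansion l d = x"
proof -
  have l: "0 < l" "l \<le> 1 / real m" "x \<in> K_set m l"
    using assms(2) by (auto simp: Lambda_set_def)
  then have "l < 1" using ratio_less_one assms(1) by blast
  then show thesis using l K_set_eq_expansions[of m l] assms(1) that by auto
qed

lemma Lambda_setI:
  assumes "2 \<le> m" "0 < l" "l \<le> 1 / real m" "d \<in> digit_seqs m" "expansion l d = x"
  shows "l \<in> Lambda_set m x"
  using assms K_set_eq_expansions[of m l] ratio_less_one[of m l] by (auto simp: Lambda_set_def)

text \<open>
  A lower bound on the value bounds the position of the first nonzero digit uniformly in the
  sequence and in the ratio; this makes the growth rate in the ratio uniform over the parameter set.
\<close>

lemma ex_early_nonzero_digit: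
  assumes "2 \<le> m" "d \<in> digit_seqs m" "0 \<le> l" "l \<le> 1 / real m" "(1 / 2) ^ n < expansion l d"
  obtains k where "k < n" "1 \<le> d k"
proof (cases "\<exists>k<n. 1 \<le> d k")
  case True
  then show thesis using that by blast
next
  case False
  then have "d i = 0" if "i < n" for i using that by (force simp: not_le)
  moreover have "(\<lambda>_. 0) \<in> digit_seqs m" using assms by (simp add: digit_seqs_def)
  ultimately have "\<bar>expansion l d - expansion l (\<lambda>_. 0)\<bar> \<le> l ^ n"
    using assms by (intro expansion_agree) auto
  then have "expansion l d \<le> l ^ n" by (simp add: expansion_def)
  also have "\<dots> \<le> (1 / 2) ^ n"
    using ratio_less_one[OF assms(1,4)] assms by (intro power_mono) auto
  finally show thesis using assms by simp
qed

text \<open>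
  Suppose that the codes \<open>d\<close>, \<open>e\<close> of \<open>x\<close> at the ratios \<open>u \<le> v\<close> share \<open>n\<close> digits. Keeping \<open>d\<close> and
  moving the ratio from \<open>u\<close> to \<open>v\<close> raises the value from \<open>x\<close> by at least a constant times \<open>v - u\<close>.
  Exchanging \<open>d\<close> for \<open>e\<close> at \<open>v\<close> returns to \<open>x\<close>, at a cost of at most \<open>v^n\<close>. So \<open>v - u\<close> is at most a
  multiple of \<open>b^n\<close>, as required by the covering bound. The constant is uniform because \<open>x\<close> forces
  both \<open>u \<ge> x/m\<close> and an early nonzero digit.
\<close>

lemma hausdorff_dim_Lambda_le:
  assumes "2 \<le> m" "0 < x" "0 < b" "b < 1"
  shows "hausdorff_dim (Lambda_set m x \<inter> {..b}) \<le> ereal (ln (real m) / (- ln b))"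
proof -
  \<comment> \<open>All codes of \<open>x\<close> have a nonzero digit before position \<open>K\<close>, so \<open>c\<close> bounds their growth from below.\<close>
  obtain K where K: "(1 / 2) ^ K < x"
    using real_arch_pow_inv[OF \<open>0 < x\<close>, of "1 / 2"] by auto
  define c where "c = (x / real m) ^ K"
  have c: "0 < c" using assms by (simp add: c_def)
  have "\<forall>u\<in>Lambda_set m x. \<exists>d. d \<in> digit_seqs m \<and> expansion u d = x"
    using Lambda_setE[OF assms(1)] by metis
  from bchoice[OF this]
  obtain \<kappa> where \<kappa>: "\<forall>u\<in>Lambda_set m x. \<kappa> u \<in> digit_seqs m \<and> expansion u (\<kappa> u) = x"
    by blast
  have near: "dist u v \<le> 1 / c * b ^ n"
    if "u \<le> v" and u: "u \<in> Lambda_set m x" and v: "v \<in> Lambda_set m x" "v \<le> b"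
      and agree: "\<And>i. i < n \<Longrightarrow> \<kappa> u i = \<kappa> v i" for u v n
  proof -
    have ub: "0 < u" "u \<le> 1 / real m" and vb: "0 < v" "v \<le> 1 / real m"
      using u v Lambda_setE[OF assms(1)] by metis+
    have code: "\<kappa> u \<in> digit_seqs m" "\<kappa> v \<in> digit_seqs m" "expansion u (\<kappa> u) = x" "expansion v (\<kappa> v) = x"
      using \<kappa> u v by auto
    obtain k where k: "k < K" "1 \<le> \<kappa> u k"
      using ex_early_nonzero_digit[OF assms(1) code(1), of u K] ub K code(3) by auto
    have "x \<le> real m * u"
      using expansion_le_mult_ratio[OF assms(1) code(1), of u] ub code(3) by simp
    then have "x / real m \<le> u" using assms by (simp add: pos_divide_le_eq mult.commute)
    then have "c \<le> u ^ K" unfolding c_def using assms by (intro power_mono) auto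
    also have "\<dots> \<le> u ^ k"
      using k ub ratio_less_one[OF assms(1) ub(2)] by (intro power_decreasing) auto
    finally have "c * (v - u) \<le> u ^ k * (v - u)"
      using \<open>u \<le> v\<close> by (intro mult_right_mono) auto
    also have "\<dots> \<le> expansion v (\<kappa> u) - expansion u (\<kappa> u)"
      using code ub \<open>u \<le> v\<close> k ratio_less_one[OF assms(1) vb(2)] by (intro expansion_increasing) auto
    also have "\<dots> = expansion v (\<kappa> u) - expansion v (\<kappa> v)" using code by simp
    also have "\<dots> \<le> v ^ n"
      using expansion_agree[OF assms(1) code(1,2), of v n] vb agree by auto
    also have "\<dots> \<le> b ^ n" using vb v by (intro power_mono) auto
    finally show ?thesis using c \<open>u \<le> v\<close> by (simp add: dist_real_def field_simps)
  qed
  show ?thesis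
  proof (rule hausdorff_dim_le_if_coded[where \<kappa> = \<kappa> and C = "1 / c"])
    show "\<kappa> u i < m" if "u \<in> Lambda_set m x \<inter> {..b}" for u i
      using \<kappa> that by (auto simp: digit_seqs_def)
    show "dist u v \<le> 1 / c * b ^ n"
      if "u \<in> Lambda_set m x \<inter> {..b}" "v \<in> Lambda_set m x \<inter> {..b}" "\<And>i. i < n \<Longrightarrow> \<kappa> u i = \<kappa> v i" for n u v
    proof (cases "u \<le> v")
      case True
      then show ?thesis using that by (intro near) auto
    next
      case False
      then have "dist v u \<le> 1 / c * b ^ n" using that by (intro near) auto
      then show ?thesis by (simp add: dist_commute)
    qed
  qed (use assms c in auto)
qed

text \<open>
  Near \<open>l\<close> the parameter set contains a copy of the full digit space: keep a long prefix of the
  code of \<open>x\<close> at \<open>l\<close> and continue with an arbitrary sequence. The change of the tail is so small that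
  the ratio can be corrected within \<open>[a,b]\<close> to represent \<open>x\<close> again. Ratios \<open>u\<close>, \<open>v\<close> obtained from tails
  that first differ at position \<open>n\<close> are separated: at \<open>v\<close> the two sequences have values that differ
  by at least a multiple of \<open>a^n\<close>, and one of these values is \<open>x\<close>, while the other sequence takes the
  value \<open>x\<close> at \<open>u\<close>; values change only at a bounded rate with the ratio.
\<close>

lemma hausdorff_dim_Lambda_ge:
  assumes "2 \<le> m" "0 < x" "l \<in> Lambda_set m x" "0 < a" "a < l" "l < b" "b < 1 / real m"
  shows "ereal (ln (real m) / (- ln a)) \<le> hausdorff_dim (Lambda_set m x \<inter> {a..b})"
proof -
  obtain d where d: "0 < l" "l \<le> 1 / real m" "d \<in> digit_seqs m" "expansion l d = x"
    using Lambda_setE assms by blast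
  have bl: "b < 1" "l < 1" "a < 1" using ratio_less_one[of m b] assms by auto
  obtain n\<^sub>0 where "(1 / 2) ^ n\<^sub>0 < x"
    using real_arch_pow_inv[OF \<open>0 < x\<close>, of "1 / 2"] by auto
  then obtain k where k: "1 \<le> d k"
    using ex_early_nonzero_digit[OF assms(1) d(3), of l n\<^sub>0] d by auto
  have "(\<lambda>n. l ^ n) \<longlonglongrightarrow> 0" using d bl by (intro LIMSEQ_realpow_zero) auto
  then have "eventually (\<lambda>n. l ^ n < l ^ k * (b - l)) sequentially"
    and "eventually (\<lambda>n. l ^ n < a ^ k * (l - a)) sequentially"
    using assms d by (auto intro!: order_tendstoD(2))
  then have "eventually (\<lambda>n. k < n \<and> l ^ n < l ^ k * (b - l) \<and> l ^ n < a ^ k * (l - a)) sequentially"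
    using eventually_gt_at_top[of k] by eventually_elim simp
  \<comment> \<open>The prefix retains a nonzero digit, and changing the tail moves the value at \<open>l\<close> by less than moving the ratio from \<open>l\<close> to \<open>a\<close> or \<open>b\<close> does.\<close>
  then obtain N where N: "k < N" "l ^ N < l ^ k * (b - l)" "l ^ N < a ^ k * (l - a)"
    by (auto simp: eventually_sequentially)
  define glue where "glue e = (\<lambda>i. if i < N then d i else e (i - N))" for e :: "nat \<Rightarrow> nat"
  have glue: "glue e \<in> digit_seqs m" if "e \<in> digit_seqs m" for e
    using that d(3) by (simp add: glue_def digit_seqs_def)
  have "\<forall>e\<in>digit_seqs m. \<exists>u. u \<in> {a..b} \<and> expansion u (glue e) = x"
  proof
    fix e assume e: "e \<in> digit_seqs m"
    have close: "\<bar>expansion l (glue e) - x\<bar> \<le> l ^ N"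
      unfolding d(4)[symmetric] using assms(1) d glue[OF e]
      by (intro expansion_agree) (auto simp: glue_def)
    have gk: "1 \<le> glue e k" using k N by (simp add: glue_def)
    have "a ^ k * (l - a) \<le> expansion l (glue e) - expansion a (glue e)"
      using assms bl gk by (intro expansion_increasing[OF glue[OF e]]) auto
    moreover have "l ^ k * (b - l) \<le> expansion b (glue e) - expansion l (glue e)"
      using assms bl d gk by (intro expansion_increasing[OF glue[OF e]]) auto
    ultimately have "expansion a (glue e) \<le> x" "x \<le> expansion b (glue e)"
      using close N by linarith+
    then obtain u where "a \<le> u" "u \<le> b" "expansion u (glue e) = x"
      using expansion_root[OF assms(1) glue[OF e], of a b x] assms by auto
    then show "\<exists>u. u \<in> {a..b} \<and> expansion u (glue e) = x" by auto
  qed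
  from bchoice[OF this]
  obtain \<phi> where \<phi>: "\<forall>e\<in>digit_seqs m. \<phi> e \<in> {a..b} \<and> expansion (\<phi> e) (glue e) = x"
    by blast
  define \<gamma> where "\<gamma> = 1 - (real m - 1) * b / (1 - b)"
  define L where "L = real m / (1 - b)\<^sup>2"
  have \<gamma>: "0 < \<gamma>" unfolding \<gamma>_def using assms by (intro gap_constant_pos) auto
  have L: "0 < L" unfolding L_def using assms bl by simp
  show ?thesis
  proof (rule hausdorff_dim_ge_if_separated[where \<phi> = \<phi> and c = "\<gamma> * a ^ Suc N / L"])
    show "\<phi> ` digit_seqs m \<subseteq> Lambda_set m x \<inter> {a..b}"
    proof
      fix u assume "u \<in> \<phi> ` digit_seqs m"
      then obtain e where e: "e \<in> digit_seqs m" "u = \<phi> e" by blast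
      then have "u \<in> {a..b}" "expansion u (glue e) = x" using \<phi> by auto
      moreover from this have "u \<in> Lambda_set m x"
        using assms by (intro Lambda_setI[OF _ _ _ glue[OF e(1)]]) auto
      ultimately show "u \<in> Lambda_set m x \<inter> {a..b}" by blast
    qed
  next
    fix n e f
    assume ef: "e \<in> digit_seqs m" "f \<in> digit_seqs m" and agree: "\<And>i. i < n \<Longrightarrow> e i = f i" and less: "f n < e n"
    have u: "a \<le> \<phi> e" "\<phi> e \<le> b" "expansion (\<phi> e) (glue e) = x"
      and v: "a \<le> \<phi> f" "\<phi> f \<le> b" "expansion (\<phi> f) (glue f) = x"
      using \<phi> ef by auto
    have "\<gamma> * a ^ Suc (N + n) \<le> \<gamma> * \<phi> f ^ Suc (N + n)"
      using \<gamma> v assms by (intro mult_left_mono power_mono) auto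
    also have "\<dots> \<le> expansion (\<phi> f) (glue e) - expansion (\<phi> f) (glue f)"
      using expansion_gap[of "glue e" m "glue f" "\<phi> f" b "N + n"] glue ef v assms bl agree less
      by (simp add: \<gamma>_def glue_def mult.commute)
    also have "\<dots> = expansion (\<phi> f) (glue e) - expansion (\<phi> e) (glue e)"
      using u v by simp
    also have "\<dots> \<le> L * \<bar>\<phi> f - \<phi> e\<bar>"
      using expansion_lipschitz[of "glue e" m "\<phi> f" b "\<phi> e"] glue ef u v assms bl
      by (simp add: L_def)
    finally show "\<gamma> * a ^ Suc N / L * a ^ n \<le> dist (\<phi> e) (\<phi> f)"
      using L by (simp add: dist_real_def field_simps power_add abs_minus_commute)
  next
    show "0 < \<gamma> * a ^ Suc N / L" using \<gamma> L assms by simp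
  qed (use assms bl in auto)
qed

text \<open>
  The separation argument needs a ratio below \<open>1/m\<close>. At the endpoint \<open>l = 1/m\<close> take the code at
  \<open>1/m\<close> of a number \<open>y\<close> slightly above \<open>x\<close>; this is possible since \<open>x < 1\<close>. Lowering the ratio a
  little brings the value of this code down to \<open>x\<close>.
\<close>

lemma Lambda_set_approx_from_below:
  assumes "2 \<le> m" "x \<in> {0<..<1}" "l \<in> Lambda_set m x" "0 < a" "a < l"
  obtains u where "u \<in> Lambda_set m x" "a < u" "u \<le> l" "u < 1 / real m"
proof (cases "l < 1 / real m")
  case True
  then show thesis using assms that by blast
next
  case False
  then have l: "l = 1 / real m" using assms(3) by (auto simp: Lambda_set_def)
  have a: "a < 1" using assms l ratio_less_one[of m a] by auto
  obtain K where K: "(1 / 2) ^ K < x"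
    using real_arch_pow_inv[of x "1 / 2"] assms by auto
  \<comment> \<open>\<open>y\<close> is close enough to \<open>x\<close> that its code has a value below \<open>x\<close> at the ratio \<open>a\<close>.\<close>
  have "x < min 1 (x + a ^ K * (l - a))" using assms by auto
  then obtain y where "x < y" "y < min 1 (x + a ^ K * (l - a))" using dense by blast
  then have y: "x < y" "y < 1" "y < x + a ^ K * (l - a)" by auto
  then obtain d where d: "d \<in> digit_seqs m" "expansion (1 / real m) d = y"
    using ex_base_expansion[of m y] assms by auto
  obtain k where k: "k < K" "1 \<le> d k"
    using ex_early_nonzero_digit[OF assms(1) d(1), of "1 / real m" K] K d y by auto
  have "a ^ K * (l - a) \<le> a ^ k * (l - a)"
    using k a assms by (intro mult_right_mono power_decreasing) auto
  also have "\<dots> \<le> expansion l d - expansion a d"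
    using d k assms l ratio_less_one[of m l] by (intro expansion_increasing) auto
  finally have ax: "expansion a d < x" using d y l by simp
  then obtain u where u: "a \<le> u" "u \<le> 1 / real m" "expansion u d = x"
    using expansion_root[OF assms(1) d(1), of a "1 / real m" x] assms d y l by auto
  moreover have "u \<noteq> a" "u \<noteq> 1 / real m" using u ax d y by auto
  moreover have "u \<in> Lambda_set m x"
    using u assms d by (intro Lambda_setI[of m u d]) auto
  ultimately show thesis using that[of u] l by simp
qed

lemma tendsto_similarity_dim:
  assumes "0 < l" "l < 1" "(f \<longlongrightarrow> l) F"
  shows "((\<lambda>t. ereal (ln (real m) / (- ln (f t)))) \<longlongrightarrow> ereal (ln (real m) / (- ln l))) F"
  using assms by (intro tendsto_intros) auto

lemma hausdorff_dim_Lambda_nhd_ge: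
  assumes "2 \<le> m" "x \<in> {0<..<1}" "l \<in> Lambda_set m x" "0 < \<delta>"
  shows "ereal (ln (real m) / (- ln l)) \<le> hausdorff_dim (Lambda_set m x \<inter> {l - \<delta><..<l + \<delta>})"
proof (rule tendsto_upperbound)
  have l: "0 < l" "l \<le> 1 / real m" using assms(3) by (auto simp: Lambda_set_def)
  then have "l < 1" using ratio_less_one assms(1) by blast
  then show "((\<lambda>a. ereal (ln (real m) / (- ln a))) \<longlongrightarrow> ereal (ln (real m) / (- ln l))) (at_left l)"
    using l by (intro tendsto_similarity_dim tendsto_ident_at)
  have "eventually (\<lambda>a. a \<in> {max 0 (l - \<delta>)<..<l}) (at_left l)"
    using l assms(4) by (intro eventually_at_left_real) auto
  then show "eventually (\<lambda>a. ereal (ln (real m) / (- ln a))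
      \<le> hausdorff_dim (Lambda_set m x \<inter> {l - \<delta><..<l + \<delta>})) (at_left l)"
  proof eventually_elim
    case (elim a)
    then have a: "0 < a" "l - \<delta> < a" "a < l" by auto
    \<comment> \<open>For \<open>l = 1/m\<close> there is no room above \<open>l\<close>, so the argument is applied around a nearby \<open>u\<close>.\<close>
    obtain u where u: "u \<in> Lambda_set m x" "a < u" "u \<le> l" "u < 1 / real m"
      using Lambda_set_approx_from_below[OF assms(1-3) a(1,3)] by blast
    then have "u < min (1 / real m) (l + \<delta>)" using assms by auto
    then obtain b where b: "u < b" "b < min (1 / real m) (l + \<delta>)" using dense by blast
    have "ereal (ln (real m) / (- ln a)) \<le> hausdorff_dim (Lambda_set m x \<inter> {a..b})"
      using assms u a b by (intro hausdorff_dim_Lambda_ge[where l = u]) auto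
    also have "\<dots> \<le> hausdorff_dim (Lambda_set m x \<inter> {l - \<delta><..<l + \<delta>})"
      using a b by (intro hausdorff_dim_mono) auto
    finally show ?case .
  qed
qed simp

theorem theorem1p2:
  fixes m :: nat and x l :: real
  assumes "m \<ge> 2"
    and "x \<in> {0<..<1}"
    and "l \<in> Lambda_set m x"
  shows "((\<lambda>\<delta>. hausdorff_dim (Lambda_set m x \<inter> {l - \<delta><..<l + \<delta>}))
            \<longlongrightarrow> hausdorff_dim (K_set m l)) (at_right 0)
         \<and> hausdorff_dim (K_set m l) = ereal (ln (real m) / (- ln l))"
proof
  have l: "0 < l" "l \<le> 1 / real m" using assms(3) by (auto simp: Lambda_set_def)
  then have "l < 1" using ratio_less_one assms(1) by blast
  show dim: "hausdorff_dim (K_set m l) = ereal (ln (real m) / (- ln l))"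
    using hausdorff_dim_K_set assms l by blast
  show "((\<lambda>\<delta>. hausdorff_dim (Lambda_set m x \<inter> {l - \<delta><..<l + \<delta>}))
            \<longlongrightarrow> hausdorff_dim (K_set m l)) (at_right 0)"
    unfolding dim
  proof (rule tendsto_sandwich)
    show "((\<lambda>_. ereal (ln (real m) / (- ln l))) \<longlongrightarrow> ereal (ln (real m) / (- ln l))) (at_right 0)"
      by simp
    have "((\<lambda>\<delta>. l + \<delta>) \<longlongrightarrow> l + 0) (at_right 0)"
      by (intro tendsto_intros)
    then show "((\<lambda>\<delta>. ereal (ln (real m) / (- ln (l + \<delta>)))) \<longlongrightarrow> ereal (ln (real m) / (- ln l))) (at_right 0)"
      using l \<open>l < 1\<close> by (intro tendsto_similarity_dim) auto
    have small: "eventually (\<lambda>\<delta>. \<delta> \<in> {0<..<1 - l}) (at_right 0)"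
      using \<open>l < 1\<close> by (intro eventually_at_right_real) auto
    then show "eventually (\<lambda>\<delta>. ereal (ln (real m) / (- ln l))
        \<le> hausdorff_dim (Lambda_set m x \<inter> {l - \<delta><..<l + \<delta>})) (at_right 0)"
      by eventually_elim (use assms in \<open>intro hausdorff_dim_Lambda_nhd_ge, simp_all\<close>)
    from small show "eventually (\<lambda>\<delta>. hausdorff_dim (Lambda_set m x \<inter> {l - \<delta><..<l + \<delta>})
        \<le> ereal (ln (real m) / (- ln (l + \<delta>)))) (at_right 0)"
    proof eventually_elim
      case (elim \<delta>)
      have "hausdorff_dim (Lambda_set m x \<inter> {l - \<delta><..<l + \<delta>})
          \<le> hausdorff_dim (Lambda_set m x \<inter> {..l + \<delta>})"
        by (intro hausdorff_dim_mono) auto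
      also have "\<dots> \<le> ereal (ln (real m) / (- ln (l + \<delta>)))"
        using assms l elim by (intro hausdorff_dim_Lambda_le) auto
      finally show ?case .
    qed
  qed
qed

end
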